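(* Let $G$ be a countable group and let $X$ be a metrizable, locally compact and separable space endowed with a Radon measure $\nu$. Suppose that $G$ acts measurably on $X$ and quasi-preserves $\nu$. If the action of $G$ on $(X,\nu)$ is locally somewhere free, then the regular representation $\lambda$ of $G$ is weakly contained in the unitary representation $\rho_X$ of $G$ on $L^2(X)=L^2(X,\nu)$.
   Context: Locally somewhere free: the action of $G$ on $(X,\nu)$ is locally somewhere free if for every finite subset $K\subset G$ there is a Borel subset $F\subset X$ of positive measure such that for every $\gamma\in K$ with $\gamma\neq 1$ one has $\gamma\cdot x\neq x$ for $\nu$-almost every $x\in F$. The representation $\rho_X$: since $G$ quasi-preserves $\nu$ (i.e. each $g\in G$ maps $\nu$ to a measure equivalent to $\nu$), one defines the unitary representation $\rho_X: G\to \mathcal U(L^2(X))$ by $$\rho_X(g)(f)(x)=\left(\frac{dg^{-1}\nu}{d\nu}(x)\right)^{1/2} f(g^{-1}\cdot x),$$ where $\frac{dg^{-1}\nu}{d\nu}$ denotes the Radon-Nikodym derivative (with the convention for translating $\nu$ that makes $\rho_X(g)$ unitary). The regular representation $\lambda$ of $G$ on $\ell^2(G)$ is $\lambda(g)(\xi)(h)=\xi(g^{-1}h)$. Weak containment: for unitary representations $(\pi_1,\mathcal H_1)$, $(\pi_2,\mathcal H_2)$ of $G$, $\pi_1$ is weakly contained in $\pi_2$ (written $\pi_1\prec\pi_2$) if for all $\epsilon>0$, $\xi\in\mathcal H_1$ and finite $K\subset G$ there are vectors $\nu_1,\dots,\nu_n\in\mathcal H_2$ such that for all $g\in K$, $\left|\langle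 \pi_1(g)\xi\,|\,\xi\rangle-\sum_{i=1}^n\langle\pi_2(g)\nu_i\,|\,\nu_i\rangle\right|<\epsilon$. *)

theory Defs
  imports "HOL-Analysis.Analysis" "HOL-Algebra.Group_Action"
begin

text \<open>Meant for Hausdorff spaces, where compact sets are Borel.\<close>

definition radon_measure :: "'x::topological_space measure \<Rightarrow> bool" where
  "radon_measure \<nu> \<longleftrightarrow>
     sets \<nu> = sets borel \<and>
     (\<forall>K. compact K \<longrightarrow> emeasure \<nu> K < \<infinity>) \<and>
     (\<forall>B\<in>sets borel. emeasure \<nu> B = (INF U \<in> {U. open U \<and> B \<subseteq> U}. emeasure \<nu> U)) \<and>
     (\<forall>U. open U \<longrightarrow> emeasure \<nu> U =
        (SUP K \<in> {K. compact K \<and> K \<subseteq> U}. emeasure \<nu> K))"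

definition acts_measurably :: "('g, 'm) monoid_scheme \<Rightarrow> ('g \<Rightarrow> 'x \<Rightarrow> 'x) \<Rightarrow> 'x measure \<Rightarrow> bool" where
  "acts_measurably G \<phi> \<nu> \<longleftrightarrow>
     group_action G (space \<nu>) \<phi> \<and> (\<forall>g\<in>carrier G. \<phi> g \<in> measurable \<nu> \<nu>)"

definition quasi_preserves :: "('g, 'm) monoid_scheme \<Rightarrow> ('g \<Rightarrow> 'x \<Rightarrow> 'x) \<Rightarrow> 'x measure \<Rightarrow> bool" where
  "quasi_preserves G \<phi> \<nu> \<longleftrightarrow>
     (\<forall>g\<in>carrier G. absolutely_continuous \<nu> (distr \<nu> \<nu> (\<phi> g)) \<and>
                     absolutely_continuous (distr \<nu> \<nu> (\<phi> g)) \<nu>)"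

definition locally_somewhere_free ::
    "('g, 'm) monoid_scheme \<Rightarrow> ('g \<Rightarrow> 'x \<Rightarrow> 'x) \<Rightarrow> 'x measure \<Rightarrow> bool" where
  "locally_somewhere_free G \<phi> \<nu> \<longleftrightarrow>
     (\<forall>K. finite K \<and> K \<subseteq> carrier G \<longrightarrow>
        (\<exists>F\<in>sets \<nu>. emeasure \<nu> F > 0 \<and>
           (\<forall>\<gamma>\<in>K. \<gamma> \<noteq> \<one>\<^bsub>G\<^esub> \<longrightarrow> (AE x in \<nu>. x \<in> F \<longrightarrow> \<phi> \<gamma> x \<noteq> x))))"

text \<open>Weak containment involves a Hilbert space only through its set of vectors and its inner
  product, so these are the components recorded.\<close>

record 'h hilbert =
  vectors :: "'h set"
  inner_prod :: "'h \<Rightarrow> 'h \<Rightarrow> complex"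

definition weakly_contained ::
    "('g, 'm) monoid_scheme \<Rightarrow> 'h hilbert \<Rightarrow> ('g \<Rightarrow> 'h \<Rightarrow> 'h) \<Rightarrow> 'k hilbert \<Rightarrow> ('g \<Rightarrow> 'k \<Rightarrow> 'k) \<Rightarrow> bool" where
  "weakly_contained G H1 \<pi>1 H2 \<pi>2 \<longleftrightarrow>
     (\<forall>\<epsilon>>0. \<forall>\<xi>\<in>vectors H1. \<forall>K. finite K \<and> K \<subseteq> carrier G \<longrightarrow>
        (\<exists>(n::nat) \<eta>. (\<forall>i\<in>{1..n}. \<eta> i \<in> vectors H2) \<and>
           (\<forall>g\<in>K. cmod (inner_prod H1 (\<pi>1 g \<xi>) \<xi> -
                       (\<Sum>i=1..n. inner_prod H2 (\<pi>2 g (\<eta> i)) (\<eta> i))) < (\<epsilon>::real))))"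

text \<open>Functions on the group are represented by their extension by \<open>0\<close> outside the carrier.\<close>

definition ell2 :: "('g, 'm) monoid_scheme \<Rightarrow> ('g \<Rightarrow> complex) hilbert" where
  "ell2 G = \<lparr>
     vectors = {\<xi>. (\<forall>h. h \<notin> carrier G \<longrightarrow> \<xi> h = 0) \<and>
                   (\<lambda>h. (cmod (\<xi> h))\<^sup>2) summable_on carrier G},
     inner_prod = (\<lambda>\<xi> \<eta>. \<Sum>\<^sub>\<infinity>h\<in>carrier G. \<xi> h * cnj (\<eta> h)) \<rparr>"

definition regular_rep :: "('g, 'm) monoid_scheme \<Rightarrow> 'g \<Rightarrow> ('g \<Rightarrow> complex) \<Rightarrow> ('g \<Rightarrow> complex)" where
  "regular_rep G g \<xi> = (\<lambda>h. if h \<in> carrier G then \<xi> (inv\<^bsub>G\<^esub> g \<otimes>\<^bsub>G\<^esub> h) else 0)"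

definition square_integrable :: "'x measure \<Rightarrow> ('x \<Rightarrow> complex) set" where
  "square_integrable M =
     {f. f \<in> borel_measurable M \<and> integrable M (\<lambda>x. (cmod (f x))\<^sup>2)}"

definition ae_eq :: "'x measure \<Rightarrow> (('x \<Rightarrow> complex) \<times> ('x \<Rightarrow> complex)) set" where
  "ae_eq M = {(f, g). f \<in> square_integrable M \<and> g \<in> square_integrable M \<and> (AE x in M. f x = g x)}"

definition L2 :: "'x measure \<Rightarrow> ('x \<Rightarrow> complex) set hilbert" where
  "L2 M = \<lparr>
     vectors = square_integrable M // ae_eq M,
     inner_prod = (\<lambda>A B. the_elem (\<Union>f\<in>A. \<Union>g\<in>B. {LINT x|M. f x * cnj (g x)})) \<rparr>"

text \<open>The Radon-Nikodym derivative has to be the one of the measure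
  \<open>A \<mapsto> \<nu> (g\<inverse> A)\<close>, that is, of the push-forward of \<open>\<nu>\<close> under \<open>x \<mapsto> g x\<close>: this choice makes the
  representation unitary.\<close>

definition koopman_fun ::
    "('g, 'm) monoid_scheme \<Rightarrow> ('g \<Rightarrow> 'x \<Rightarrow> 'x) \<Rightarrow> 'x measure \<Rightarrow> 'g \<Rightarrow> ('x \<Rightarrow> complex) \<Rightarrow> ('x \<Rightarrow> complex)" where
  "koopman_fun G \<phi> \<nu> g f =
     (\<lambda>x. complex_of_real (sqrt (enn2real (RN_deriv \<nu> (distr \<nu> \<nu> (\<phi> g)) x))) * f (\<phi> (inv\<^bsub>G\<^esub> g) x))"

definition koopman_rep ::
    "('g, 'm) monoid_scheme \<Rightarrow> ('g \<Rightarrow> 'x \<Rightarrow> 'x) \<Rightarrow> 'x measure \<Rightarrow> 'g \<Rightarrow> ('x \<Rightarrow> complex) set \<Rightarrow> ('x \<Rightarrow> complex) set" where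
  "koopman_rep G \<phi> \<nu> g A = (\<Union>f\<in>A. ae_eq \<nu> `` {koopman_fun G \<phi> \<nu> g f})"

text \<open>The operations on classes are well defined, and the representation is isometric.\<close>

lemma equiv_ae_eq: "equiv (square_integrable M) (ae_eq M)"
proof (rule equivI)
  show "sym (ae_eq M)"
    by (rule symI) (auto simp: ae_eq_def eq_commute)
  show "trans (ae_eq M)"
  proof (rule transI)
    fix f g h assume fg: "(f, g) \<in> ae_eq M" and gh: "(g, h) \<in> ae_eq M"
    have "AE x in M. f x = g x" "AE x in M. g x = h x"
      using fg gh by (auto simp: ae_eq_def)
    then have "AE x in M. f x = h x"
      by eventually_elim simp
    then show "(f, h) \<in> ae_eq M"
      using fg gh by (simp add: ae_eq_def)
  qed
qed (auto simp: ae_eq_def refl_on_def)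

lemma borel_measurable_cnj [measurable (raw)]:
  "f \<in> borel_measurable M \<Longrightarrow> (\<lambda>x. cnj (f x)) \<in> borel_measurable M"
  by (erule measurable_compose) (intro borel_measurable_continuous_onI continuous_intros)

lemma L2_inner_class:
  assumes "f \<in> square_integrable M" "g \<in> square_integrable M"
  shows "inner_prod (L2 M) (ae_eq M `` {f}) (ae_eq M `` {g}) = (LINT x|M. f x * cnj (g x))"
proof -
  have inv: "(LINT x|M. f' x * cnj (g' x)) = (LINT x|M. f x * cnj (g x))"
    if "(f, f') \<in> ae_eq M" "(g, g') \<in> ae_eq M" for f' g'
  proof (rule integral_cong_AE)
    have "AE x in M. f x = f' x" "AE x in M. g x = g' x"
      using that by (auto simp: ae_eq_def)
    then show "AE x in M. f' x * cnj (g' x) = f x * cnj (g x)"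
      by eventually_elim simp
  qed (use that in \<open>auto simp: ae_eq_def square_integrable_def intro!: borel_measurable_times borel_measurable_cnj\<close>)
  have refl: "(f, f) \<in> ae_eq M" "(g, g) \<in> ae_eq M"
    using assms by (auto simp: ae_eq_def)
  have "(\<Union>f'\<in>ae_eq M `` {f}. \<Union>g'\<in>ae_eq M `` {g}. {LINT x|M. f' x * cnj (g' x)})
      = {LINT x|M. f x * cnj (g x)}" (is "?U = _")
  proof (intro subset_antisym subsetI)
    fix c assume "c \<in> ?U"
    then obtain f' g' where "(f, f') \<in> ae_eq M" "(g, g') \<in> ae_eq M" "c = (LINT x|M. f' x * cnj (g' x))"
      by (elim UN_E ImageE singletonE) simp
    then show "c \<in> {LINT x|M. f x * cnj (g x)}"
      using inv by simp
  next
    fix c assume "c \<in> {LINT x|M. f x * cnj (g x)}"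
    then show "c \<in> ?U"
      using refl by (intro UN_I[of f] UN_I[of g] ImageI[of f] ImageI[of g]) auto
  qed
  then show ?thesis
    by (simp add: L2_def)
qed

context
  fixes G :: "('g, 'm) monoid_scheme" and \<phi> :: "'g \<Rightarrow> 'x \<Rightarrow> 'x" and \<nu> :: "'x measure" and g
  assumes G: "group G" and act: "acts_measurably G \<phi> \<nu>" and qp: "quasi_preserves G \<phi> \<nu>"
    and sf: "sigma_finite_measure \<nu>" and g: "g \<in> carrier G"
begin

private lemma phi_meas: "h \<in> carrier G \<Longrightarrow> \<phi> h \<in> measurable \<nu> \<nu>"
  using act by (auto simp: acts_measurably_def)

private lemma inv_g: "inv\<^bsub>G\<^esub> g \<in> carrier G"
  using G g by (simp add: group.inv_closed)

private lemma phi_inv: "x \<in> space \<nu> \<Longrightarrow> \<phi> (inv\<^bsub>G\<^esub> g) (\<phi> g x) = x"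
  using act g group_action.orbit_sym_aux[of G "space \<nu>" \<phi> g x "\<phi> g x"]
  by (auto simp: acts_measurably_def)

lemma density_RN_push:
  "density \<nu> (RN_deriv \<nu> (distr \<nu> \<nu> (\<phi> g))) = distr \<nu> \<nu> (\<phi> g)"
  using sf qp g by (intro sigma_finite_measure.density_RN_deriv) (auto simp: quasi_preserves_def)

lemma RN_push_finite: "AE x in \<nu>. RN_deriv \<nu> (distr \<nu> \<nu> (\<phi> g)) x \<noteq> \<infinity>"
proof -
  interpret sigma_finite_measure \<nu> by (fact sf)
  have "sigma_finite_measure (distr (distr \<nu> \<nu> (\<phi> g)) \<nu> (\<phi> (inv\<^bsub>G\<^esub> g)))"
  proof -
    have "distr (distr \<nu> \<nu> (\<phi> g)) \<nu> (\<phi> (inv\<^bsub>G\<^esub> g)) = distr \<nu> \<nu> (\<phi> (inv\<^bsub>G\<^esub> g) \<circ> \<phi> g)"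
      by (rule distr_distr) (use phi_meas g inv_g in auto)
    also have "\<dots> = distr \<nu> \<nu> (\<lambda>x. x)"
      by (rule distr_cong) (auto simp: phi_inv)
    finally have "distr (distr \<nu> \<nu> (\<phi> g)) \<nu> (\<phi> (inv\<^bsub>G\<^esub> g)) = distr \<nu> \<nu> (\<lambda>x. x)" .
    then show ?thesis using sf by simp
  qed
  then have "sigma_finite_measure (distr \<nu> \<nu> (\<phi> g))"
    by (rule sigma_finite_measure_distr) (use phi_meas inv_g in simp)
  then show ?thesis
    using qp g by (intro RN_deriv_finite) (auto simp: quasi_preserves_def)
qed

lemma koopman_fun_meas:
  assumes "f \<in> borel_measurable \<nu>"
  shows "koopman_fun G \<phi> \<nu> g f \<in> borel_measurable \<nu>"
  unfolding koopman_fun_def using measurable_compose[OF phi_meas[OF inv_g] assms] by simp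

lemma koopman_change_of_variables:
  fixes F :: "'x \<Rightarrow> complex"
  assumes F: "F \<in> borel_measurable \<nu>"
  defines "D \<equiv> \<lambda>x. enn2real (RN_deriv \<nu> (distr \<nu> \<nu> (\<phi> g)) x)"
  shows "integrable \<nu> (\<lambda>x. D x *\<^sub>R F (\<phi> (inv\<^bsub>G\<^esub> g) x)) \<longleftrightarrow> integrable \<nu> F"
    and "(LINT x|\<nu>. D x *\<^sub>R F (\<phi> (inv\<^bsub>G\<^esub> g) x)) = (LINT x|\<nu>. F x)"
proof -
  have m: "(\<lambda>x. F (\<phi> (inv\<^bsub>G\<^esub> g) x)) \<in> borel_measurable \<nu>"
    using measurable_compose[OF phi_meas[OF inv_g] F] by simp
  have Dm: "D \<in> borel_measurable \<nu>" unfolding D_def by simp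
  have "AE x in \<nu>. RN_deriv \<nu> (distr \<nu> \<nu> (\<phi> g)) x = ennreal (D x)"
    using RN_push_finite by eventually_elim (auto simp: D_def less_top)
  then have d: "density \<nu> D = distr \<nu> \<nu> (\<phi> g)"
    using Dm by (subst density_RN_push[symmetric], intro density_cong) (auto simp: D_def)
  have "integrable \<nu> (\<lambda>x. D x *\<^sub>R F (\<phi> (inv\<^bsub>G\<^esub> g) x))
      \<longleftrightarrow> integrable (density \<nu> D) (\<lambda>x. F (\<phi> (inv\<^bsub>G\<^esub> g) x))"
    using integrable_density[OF m Dm] by (simp add: D_def)
  also have "\<dots> \<longleftrightarrow> integrable \<nu> (\<lambda>x. F (\<phi> (inv\<^bsub>G\<^esub> g) (\<phi> g x)))"
    unfolding d by (rule integrable_distr_eq) (use phi_meas g m in auto)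
  also have "\<dots> \<longleftrightarrow> integrable \<nu> F"
    by (rule Bochner_Integration.integrable_cong) (auto simp: phi_inv)
  finally show "integrable \<nu> (\<lambda>x. D x *\<^sub>R F (\<phi> (inv\<^bsub>G\<^esub> g) x)) \<longleftrightarrow> integrable \<nu> F" .
  have "(LINT x|\<nu>. D x *\<^sub>R F (\<phi> (inv\<^bsub>G\<^esub> g) x)) = (LINT x|density \<nu> D. F (\<phi> (inv\<^bsub>G\<^esub> g) x))"
    using integral_density[OF m Dm] by (simp add: D_def)
  also have "\<dots> = (LINT x|\<nu>. F (\<phi> (inv\<^bsub>G\<^esub> g) (\<phi> g x)))"
    unfolding d by (rule integral_distr) (use phi_meas g m in auto)
  also have "\<dots> = (LINT x|\<nu>. F x)"
    by (rule Bochner_Integration.integral_cong) (auto simp: phi_inv)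
  finally show "(LINT x|\<nu>. D x *\<^sub>R F (\<phi> (inv\<^bsub>G\<^esub> g) x)) = (LINT x|\<nu>. F x)" .
qed

lemma koopman_fun_mult_cnj:
  "koopman_fun G \<phi> \<nu> g f x * cnj (koopman_fun G \<phi> \<nu> g f' x) =
     enn2real (RN_deriv \<nu> (distr \<nu> \<nu> (\<phi> g)) x) *\<^sub>R
       (f (\<phi> (inv\<^bsub>G\<^esub> g) x) * cnj (f' (\<phi> (inv\<^bsub>G\<^esub> g) x)))"
proof -
  have *: "complex_of_real (sqrt a) * u * cnj (complex_of_real (sqrt a) * v) = a *\<^sub>R (u * cnj v)"
    if "a \<ge> 0" for a u v
  proof -
    have "complex_of_real (sqrt a) * complex_of_real (sqrt a) = complex_of_real a"
      using that by (metis of_real_mult real_sqrt_mult_self abs_of_nonneg)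
    then show ?thesis
      by (simp add: scaleR_conv_of_real mult_ac)
  qed
  show ?thesis unfolding koopman_fun_def by (rule *) simp
qed

lemma koopman_fun_square_integrable:
  assumes f: "f \<in> square_integrable \<nu>"
  shows "koopman_fun G \<phi> \<nu> g f \<in> square_integrable \<nu>"
proof -
  have iff: "integrable \<nu> (\<lambda>x. (cmod (h x))\<^sup>2) \<longleftrightarrow> integrable \<nu> (\<lambda>x. h x * cnj (h x))" for h
    by (simp only: complex_norm_square[symmetric] complex_of_real_integrable_eq)
  have fm: "f \<in> borel_measurable \<nu>" and fi: "integrable \<nu> (\<lambda>x. f x * cnj (f x))"
    using f by (simp_all add: square_integrable_def iff)
  have "integrable \<nu> (\<lambda>x. koopman_fun G \<phi> \<nu> g f x * cnj (koopman_fun G \<phi> \<nu> g f x))"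
    unfolding koopman_fun_mult_cnj
    using koopman_change_of_variables(1)[of "\<lambda>x. f x * cnj (f x)"] fm fi by simp
  then show ?thesis
    using koopman_fun_meas[OF fm] by (simp add: square_integrable_def iff)
qed

lemma koopman_rep_class:
  assumes f: "f \<in> square_integrable \<nu>"
  shows "koopman_rep G \<phi> \<nu> g (ae_eq \<nu> `` {f}) = ae_eq \<nu> `` {koopman_fun G \<phi> \<nu> g f}"
  unfolding koopman_rep_def
proof (rule UN_equiv_class[OF equiv_ae_eq _ f], rule congruentI)
  fix h h' assume hh: "(h, h') \<in> ae_eq \<nu>"
  then have "AE x in \<nu>. h x = h' x" by (simp add: ae_eq_def)
  moreover have "absolutely_continuous \<nu> (distr \<nu> \<nu> (\<phi> (inv\<^bsub>G\<^esub> g)))"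
    using qp inv_g by (auto simp: quasi_preserves_def)
  ultimately have "AE x in distr \<nu> \<nu> (\<phi> (inv\<^bsub>G\<^esub> g)). h x = h' x"
    by (intro absolutely_continuous_AE[of "distr \<nu> \<nu> (\<phi> (inv\<^bsub>G\<^esub> g))" \<nu>, OF sets_distr])
  then have "AE x in \<nu>. h (\<phi> (inv\<^bsub>G\<^esub> g) x) = h' (\<phi> (inv\<^bsub>G\<^esub> g) x)"
    by (rule AE_distrD[OF phi_meas[OF inv_g]])
  then have "AE x in \<nu>. koopman_fun G \<phi> \<nu> g h x = koopman_fun G \<phi> \<nu> g h' x"
    by eventually_elim (simp add: koopman_fun_def)
  then show "ae_eq \<nu> `` {koopman_fun G \<phi> \<nu> g h} = ae_eq \<nu> `` {koopman_fun G \<phi> \<nu> g h'}"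
    using hh koopman_fun_square_integrable
    by (intro equiv_class_eq[OF equiv_ae_eq]) (auto simp: ae_eq_def)
qed

lemma koopman_rep_closed:
  "A \<in> vectors (L2 \<nu>) \<Longrightarrow> koopman_rep G \<phi> \<nu> g A \<in> vectors (L2 \<nu>)"
  by (auto simp: L2_def koopman_rep_class elim!: quotientE
      intro!: quotientI koopman_fun_square_integrable)

lemma koopman_rep_isometric:
  assumes "A \<in> vectors (L2 \<nu>)" "B \<in> vectors (L2 \<nu>)"
  shows "inner_prod (L2 \<nu>) (koopman_rep G \<phi> \<nu> g A) (koopman_rep G \<phi> \<nu> g B) = inner_prod (L2 \<nu>) A B"
proof -
  obtain f f' where f: "f \<in> square_integrable \<nu>" "A = ae_eq \<nu> `` {f}"
    and f': "f' \<in> square_integrable \<nu>" "B = ae_eq \<nu> `` {f'}"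
    using assms by (auto simp: L2_def elim!: quotientE)
  have "(\<lambda>x. f x * cnj (f' x)) \<in> borel_measurable \<nu>"
    using f f' by (auto simp: square_integrable_def)
  from koopman_change_of_variables(2)[OF this] show ?thesis
    using f f' by (simp add: koopman_rep_class L2_inner_class koopman_fun_square_integrable koopman_fun_mult_cnj)
qed

end

end

theory Submission
  imports Defs
begin

text \<open>
  Write \<open>\<rho>\<close> for the Koopman representation. Let \<open>\<xi>\<close> be in \<open>\<ell>\<^sup>2(G)\<close>, let \<open>S\<close> be a finite subset of \<open>G\<close>,
  and let \<open>A\<close> be a set of positive finite measure such that, for each \<open>g\<close> in the given finite set
  \<open>K\<close> and all \<open>h, k\<close> in \<open>S\<close> with \<open>g h \<noteq> k\<close>, the element \<open>k\<inverse> g h\<close> moves \<open>A\<close> off itself. With the unit vector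
  \<open>u = 1\<^sub>A / sqrt (\<nu> A)\<close>, the products \<open>\<langle>\<rho>(g) \<rho>(h) u, \<rho>(k) u\<rangle>\<close> are then \<open>1\<close> if \<open>g h = k\<close>,
  by unitarity, and \<open>0\<close> otherwise, by disjointness of supports: on these finitely many elements the
  translates of \<open>u\<close> behave like the point masses in \<open>\<ell>\<^sup>2(G)\<close>. Hence the single vector
  \<open>f = \<Sum>h\<in>S. \<xi>(h) \<rho>(h) u\<close> has, on \<open>K\<close>, exactly the coefficient that the regular representation
  attaches to the restriction of \<open>\<xi>\<close> to \<open>S\<close> (lemma \<open>koopman_coefficient_of_displaced_set\<close>).

  For a large enough \<open>S\<close> this restriction changes the coefficients of \<open>\<xi>\<close> on \<open>K\<close> by less than
  \<open>\<epsilon>\<close> (lemma \<open>regular_coefficient_truncation\<close>), so one vector already gives the approximation required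
  for weak containment.

  The set \<open>A\<close> is where freeness enters. It provides a set \<open>F\<close> of positive measure in which almost
  no point is fixed by any of the finitely many non-trivial elements \<open>k\<inverse> g h\<close>. A countable base
  separates each point from its image by one of countably many pairs of open sets, and so cuts
  \<open>F\<close> into countably many pieces, each moved off itself; one of the pieces has positive measure
  (lemma \<open>positive_subset_displaced\<close>). As the action is only measurable, the image of a
  point is localized by the preimage of a basic open set, not by a small neighbourhood of the point.
\<close>

section \<open>Second countability and sigma-finiteness\<close>

lemma metrizable_separable_imp_second_countable:
  assumes "metrizable_space X" and "separable_space X"
  shows "second_countable X"
proof -
  obtain M d where M: "Metric_space M d" and X: "X = Metric_space.mtopology M d"
    using assms(1) by (auto simp: metrizable_space_def)
  interpret Metric_space M d by (fact M)
  obtain C where C: "countable C" "C \<subseteq> M" "mtopology closure_of C = M"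
    using assms(2) by (auto simp: separable_space_def X)
  define \<B> where "\<B> = (\<lambda>(c, n). mball c (1 / Suc n)) ` (C \<times> (UNIV :: nat set))"
  have "\<exists>V\<in>\<B>. x \<in> V \<and> V \<subseteq> U" if U: "openin mtopology U" "x \<in> U" for U x
  proof -
    obtain r where r: "r > 0" "mball x r \<subseteq> U" and x: "x \<in> M"
      using U unfolding openin_mtopology by blast
    obtain n where n: "1 / Suc n < r / 2"
      using r(1) nat_approx_posE[of "r / 2"] by auto
    have "x \<in> mtopology closure_of C" using x C(3) by simp
    then have "\<forall>s>0. \<exists>y\<in>C. y \<in> mball x s"
      unfolding metric_closure_of by blast
    moreover have "1 / real (Suc n) > 0" by simp
    ultimately obtain c where c: "c \<in> C" "c \<in> mball x (1 / Suc n)"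
      by blast
    have "mball c (1 / Suc n) \<subseteq> mball x r"
    proof
      fix y assume y: "y \<in> mball c (1 / Suc n)"
      then have "d x y \<le> d x c + d c y" using c triangle x by auto
      then show "y \<in> mball x r" using y c n by auto
    qed
    moreover have "x \<in> mball c (1 / Suc n)" using c by (auto simp: commute)
    moreover have "mball c (1 / Suc n) \<in> \<B>"
      unfolding \<B>_def using c(1) by (intro image_eqI[of _ _ "(c, n)"]) auto
    ultimately show ?thesis using r(2) by blast
  qed
  moreover have "countable \<B>" using C(1) by (simp add: \<B>_def)
  moreover have "\<forall>V\<in>\<B>. openin mtopology V" by (auto simp: \<B>_def)
  ultimately show ?thesis unfolding second_countable_def X by blast
qed

lemma openin_euclidean: "openin (euclidean :: 'x::topological_space topology) = open"
  by (rule ext) (rule open_openin[symmetric])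

text \<open>Radon-Nikodym derivatives require a sigma-finite measure. A cover by interiors of compact sets
  has a countable subcover, and compact sets have finite measure.\<close>

lemma radon_measure_sigma_finite:
  fixes \<nu> :: "'x::topological_space measure"
  assumes haus: "Hausdorff_space (euclidean :: 'x topology)"
    and lc: "locally_compact_space (euclidean :: 'x topology)"
    and sc: "second_countable (euclidean :: 'x topology)"
    and radon: "radon_measure \<nu>"
  shows "sigma_finite_measure \<nu>"
proof
  have sets: "sets \<nu> = sets borel" using radon by (simp add: radon_measure_def)
  have "\<exists>U K. open U \<and> compact K \<and> x \<in> U \<and> U \<subseteq> K" for x :: 'x
    using lc by (auto simp: locally_compact_space_def)
  then obtain U K where UK: "\<And>x::'x. open (U x) \<and> compact (K x) \<and> x \<in> U x \<and> U x \<subseteq> K x"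
    by metis
  have "\<exists>\<V>. countable \<V> \<and> \<V> \<subseteq> range U \<and> \<Union>\<V> = topspace (euclidean :: 'x topology)"
    by (rule Lindelof_spaceD[OF second_countable_imp_Lindelof_space[OF sc]]) (use UK in auto)
  then obtain \<V> where \<V>: "countable \<V>" "\<V> \<subseteq> range U" "\<Union>\<V> = UNIV"
    by auto
  then obtain I where I: "countable I" "\<V> = U ` I"
    using countable_subset_image[of \<V> U UNIV] by blast
  then have cover: "(\<Union>i\<in>I. U i) = UNIV" using \<V>(3) by simp
  have "K i \<in> sets \<nu>" for i
  proof -
    have "closed (K i)"
      using compactin_imp_closedin[OF haus, of "K i"] UK by simp
    then show ?thesis using sets by simp
  qed
  moreover have "emeasure \<nu> (K i) \<noteq> \<infinity>" for i
    using radon UK[of i] by (auto simp: radon_measure_def top.not_eq_extremum)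
  moreover have "\<Union>(K ` I) = space \<nu>"
  proof -
    have "U i \<subseteq> K i" for i using UK by blast
    then have "UNIV \<subseteq> \<Union>(K ` I)" using cover by blast
    then show ?thesis using sets_eq_imp_space_eq[OF sets] by auto
  qed
  ultimately show "\<exists>A. countable A \<and> A \<subseteq> sets \<nu> \<and> \<Union>A = space \<nu> \<and> (\<forall>a\<in>A. emeasure \<nu> a \<noteq> \<infinity>)"
    using I(1) by (intro exI[of _ "K ` I"]) auto
qed

section \<open>Sets displaced by finitely many maps\<close>

text \<open>If \<open>T x \<noteq> x\<close>, then \<open>x\<close> and \<open>T x\<close> have disjoint basic neighbourhoods \<open>U\<close> and \<open>V\<close>, so \<open>x\<close> lies in
  the piece \<open>F \<inter> U \<inter> T\<inverse> V\<close>, which \<open>T\<close> maps into \<open>V\<close> and hence off itself. There are only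
  countably many such pieces, and they cover almost all of \<open>F\<close>.\<close>

lemma positive_subset_displaced:
  fixes \<nu> :: "'x::topological_space measure"
  assumes haus: "Hausdorff_space (euclidean :: 'x topology)"
    and sc: "second_countable (euclidean :: 'x topology)"
    and sets: "sets \<nu> = sets borel"
    and T: "T \<in> measurable \<nu> \<nu>"
    and F: "F \<in> sets \<nu>" "emeasure \<nu> F > 0"
    and free: "AE x in \<nu>. x \<in> F \<longrightarrow> T x \<noteq> x"
  obtains A where "A \<in> sets \<nu>" "A \<subseteq> F" "emeasure \<nu> A > 0" "\<And>x. x \<in> A \<Longrightarrow> T x \<notin> A"
proof -
  have "\<exists>\<B> :: 'x set set. countable \<B> \<and> (\<forall>V\<in>\<B>. open V) \<and>
      (\<forall>U x. open U \<and> x \<in> U \<longrightarrow> (\<exists>V\<in>\<B>. x \<in> V \<and> V \<subseteq> U))"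
    using sc unfolding second_countable_def openin_euclidean .
  then obtain \<B> :: "'x set set" where base: "countable \<B> \<and> (\<forall>V\<in>\<B>. open V) \<and>
      (\<forall>U x. open U \<and> x \<in> U \<longrightarrow> (\<exists>V\<in>\<B>. x \<in> V \<and> V \<subseteq> U))" ..
  note \<B> = conjunct1[OF base] conjunct1[OF conjunct2[OF base]] conjunct2[OF conjunct2[OF base]]
  have separate: "\<exists>U V. open U \<and> open V \<and> x \<in> U \<and> y \<in> V \<and> U \<inter> V = {}" if "x \<noteq> y" for x y :: 'x
    using haus that unfolding Hausdorff_space_def disjnt_def openin_euclidean topspace_euclidean
    by blast
  define I where "I = {(U, V) \<in> \<B> \<times> \<B>. U \<inter> V = {}}"
  define P where "P = (\<lambda>(U, V). F \<inter> U \<inter> (T -` V \<inter> space \<nu>))"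
  have I: "countable I" unfolding I_def by (rule countable_subset[of _ "\<B> \<times> \<B>"]) (use \<B>(1) in auto)
  have P_sets: "P i \<in> sets \<nu>" if "i \<in> I" for i
    using that \<B>(2) F(1) measurable_sets[OF T] sets by (auto simp: I_def P_def)
  have "\<exists>i\<in>I. emeasure \<nu> (P i) > 0"
  proof (rule ccontr)
    assume "\<not> ?thesis"
    then have "AE x in \<nu>. \<forall>i\<in>I. x \<notin> P i"
      using P_sets by (intro AE_ball_countable' I AE_not_in) (auto simp: null_sets_def)
    with free AE_space have "AE x in \<nu>. x \<notin> F"
    proof eventually_elim
      case (elim x)
      have "x \<notin> F"
      proof
        assume x: "x \<in> F"
        then obtain U V where UV: "open U" "open V" "x \<in> U" "T x \<in> V" "U \<inter> V = {}"
          using elim(1) separate[of x "T x"] by auto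
        obtain U' where U': "U' \<in> \<B>" "x \<in> U'" "U' \<subseteq> U"
          using \<B>(3)[rule_format, of U x] UV(1,3) by blast
        obtain V' where V': "V' \<in> \<B>" "T x \<in> V'" "V' \<subseteq> V"
          using \<B>(3)[rule_format, of V "T x"] UV(2,4) by blast
        then have "(U', V') \<in> I" "x \<in> P (U', V')"
          using U' V' UV(5) x elim(2) by (auto simp: I_def P_def)
        then show False using elim(3) by blast
      qed
      then show ?case .
    qed
    then have "emeasure \<nu> F = 0"
      using F(1) by (simp add: AE_iff_null_sets null_setsD1)
    then show False using F(2) by simp
  qed
  then obtain i where i: "i \<in> I" "emeasure \<nu> (P i) > 0" by blast
  show thesis
    by (rule that[of "P i"]) (use i P_sets in \<open>auto simp: I_def P_def\<close>)
qed

text \<open>Being displaced by a map is inherited by subsets, so the maps can be treated one after the other.\<close>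

lemma positive_subset_displaced_by_finite:
  fixes \<nu> :: "'x::topological_space measure"
  assumes haus: "Hausdorff_space (euclidean :: 'x topology)"
    and sc: "second_countable (euclidean :: 'x topology)"
    and sets: "sets \<nu> = sets borel"
    and "finite K"
    and "\<And>k. k \<in> K \<Longrightarrow> T k \<in> measurable \<nu> \<nu>"
    and F: "F \<in> sets \<nu>" "emeasure \<nu> F > 0"
    and "\<And>k. k \<in> K \<Longrightarrow> AE x in \<nu>. x \<in> F \<longrightarrow> T k x \<noteq> x"
  obtains A where "A \<in> sets \<nu>" "A \<subseteq> F" "emeasure \<nu> A > 0" "\<And>k x. k \<in> K \<Longrightarrow> x \<in> A \<Longrightarrow> T k x \<notin> A"
  using assms(4,5,8)
proof (induction K arbitrary: thesis rule: finite_induct)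
  case empty
  then show ?case using F by auto
next
  case (insert k K)
  obtain B where B: "B \<in> sets \<nu>" "B \<subseteq> F" "emeasure \<nu> B > 0"
    "\<And>k x. k \<in> K \<Longrightarrow> x \<in> B \<Longrightarrow> T k x \<notin> B"
    using insert.IH[OF _ insert.prems(2,3)] by blast
  have "AE x in \<nu>. x \<in> B \<longrightarrow> T k x \<noteq> x"
    using insert.prems(3)[of k] B(2) by auto
  then obtain A where "A \<in> sets \<nu>" "A \<subseteq> B" "emeasure \<nu> A > 0" "\<And>x. x \<in> A \<Longrightarrow> T k x \<notin> A"
    using positive_subset_displaced[OF haus sc sets _ B(1,3)] insert.prems(2) by blast
  then show ?case using B insert.prems(1)[of A] by blast
qed

lemma (in sigma_finite_measure) positive_subset_finite:
  assumes F: "F \<in> sets M" "emeasure M F > 0"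
  obtains A where "A \<in> sets M" "A \<subseteq> F" "emeasure M A > 0" "emeasure M A < \<infinity>"
proof (cases "emeasure M F = \<infinity>")
  case True
  then show ?thesis
    by (rule approx_PInf_emeasure_with_finite[OF F(1), of 0]) (use that in auto)
next
  case False
  then show ?thesis using F that[of F] by (auto simp: top.not_eq_extremum)
qed

section \<open>Square-integrable functions\<close>

lemma cmod_mult_le_sum_squares: "cmod a * cmod b \<le> (cmod a)\<^sup>2 + (cmod b)\<^sup>2"
  using sum_squares_bound[of "cmod a" "cmod b"] mult_nonneg_nonneg[OF norm_ge_zero[of a] norm_ge_zero[of b]]
  by linarith

lemma square_integrable_mult_cnj:
  assumes f: "f \<in> square_integrable M" and g: "g \<in> square_integrable M"
  shows "integrable M (\<lambda>x. f x * cnj (g x))"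
proof (rule Bochner_Integration.integrable_bound)
  show "integrable M (\<lambda>x. (cmod (f x))\<^sup>2 + (cmod (g x))\<^sup>2)"
    using f g by (simp add: square_integrable_def)
  show "(\<lambda>x. f x * cnj (g x)) \<in> borel_measurable M"
    using f g by (auto simp: square_integrable_def)
  show "AE x in M. norm (f x * cnj (g x)) \<le> norm ((cmod (f x))\<^sup>2 + (cmod (g x))\<^sup>2)"
    by (simp add: norm_mult cmod_mult_le_sum_squares)
qed

lemma square_integrable_add:
  assumes f: "f \<in> square_integrable M" and g: "g \<in> square_integrable M"
  shows "(\<lambda>x. f x + g x) \<in> square_integrable M"
proof -
  have [measurable]: "f \<in> borel_measurable M" "g \<in> borel_measurable M"
    using f g by (auto simp: square_integrable_def)
  have "integrable M (\<lambda>x. (cmod (f x + g x))\<^sup>2)"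
  proof (rule Bochner_Integration.integrable_bound)
    show "integrable M (\<lambda>x. 2 * (cmod (f x))\<^sup>2 + 2 * (cmod (g x))\<^sup>2)"
      using f g by (simp add: square_integrable_def)
    show "(\<lambda>x. (cmod (f x + g x))\<^sup>2) \<in> borel_measurable M" by measurable
    have "(cmod (a + b))\<^sup>2 \<le> 2 * (cmod a)\<^sup>2 + 2 * (cmod b)\<^sup>2" for a b
    proof -
      have "(cmod (a + b))\<^sup>2 \<le> (cmod a + cmod b)\<^sup>2"
        by (intro power_mono norm_triangle_ineq) simp
      then show ?thesis
        using sum_squares_bound[of "cmod a" "cmod b"] by (simp add: power2_sum)
    qed
    then show "AE x in M. norm ((cmod (f x + g x))\<^sup>2) \<le> norm (2 * (cmod (f x))\<^sup>2 + 2 * (cmod (g x))\<^sup>2)"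
      by simp
  qed
  then show ?thesis by (simp add: square_integrable_def)
qed

lemma square_integrable_cmult:
  assumes "f \<in> square_integrable M"
  shows "(\<lambda>x. c * f x) \<in> square_integrable M"
  using assms by (auto simp: square_integrable_def norm_mult power_mult_distrib)

lemma square_integrable_lincomb:
  assumes "finite S" "\<And>h. h \<in> S \<Longrightarrow> f h \<in> square_integrable M"
  shows "(\<lambda>x. \<Sum>h\<in>S. c h * f h x) \<in> square_integrable M"
  using assms
proof (induction S rule: finite_induct)
  case empty
  then show ?case by (simp add: square_integrable_def)
next
  case (insert h S)
  then show ?case
    using square_integrable_add[OF square_integrable_cmult[of "f h" M "c h"]] by auto
qed

lemma normalized_indicator_square_integrable:
  assumes A: "A \<in> sets M" "emeasure M A < \<infinity>"
  shows "(\<lambda>x. complex_of_real (indicator A x / sqrt (measure M A))) \<in> square_integrable M"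
proof -
  have "(\<lambda>x. complex_of_real (indicator A x)) \<in> square_integrable M"
  proof -
    have "(cmod (complex_of_real (indicator A x)))\<^sup>2 = indicator A x" for x
      by (simp add: indicator_def)
    moreover have "(\<lambda>x. complex_of_real (indicator A x)) \<in> borel_measurable M"
      using A(1) by simp
    ultimately show ?thesis
      using A by (simp add: square_integrable_def)
  qed
  from square_integrable_cmult[OF this, of "complex_of_real (1 / sqrt (measure M A))"]
  show ?thesis by (simp add: mult.commute)
qed

section \<open>Matrix coefficients of the Koopman representation\<close>

context
  fixes G :: "('g, 'm) monoid_scheme" and \<phi> :: "'g \<Rightarrow> 'x \<Rightarrow> 'x" and \<nu> :: "'x measure"
  assumes G: "group G" and act: "acts_measurably G \<phi> \<nu>" and qp: "quasi_preserves G \<phi> \<nu>"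
    and sf: "sigma_finite_measure \<nu>"
begin

interpretation group G by (fact G)

interpretation group_action G "space \<nu>" \<phi>
  using act by (simp add: acts_measurably_def)

private lemma phi_meas [measurable]: "h \<in> carrier G \<Longrightarrow> \<phi> h \<in> measurable \<nu> \<nu>"
  using act by (auto simp: acts_measurably_def)

private lemma phi_inv: "g \<in> carrier G \<Longrightarrow> x \<in> space \<nu> \<Longrightarrow> \<phi> (inv\<^bsub>G\<^esub> g) (\<phi> g x) = x"
  by (rule orbit_sym_aux) simp_all

text \<open>The chain rule for Radon-Nikodym derivatives: both sides are densities of the push-forward of
  \<open>\<nu>\<close> under \<open>g h\<close>, computed either at once or first along \<open>h\<close> and then along \<open>g\<close>.\<close>

lemma RN_push_cocycle:
  assumes g: "g \<in> carrier G" and h: "h \<in> carrier G"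
  shows "AE x in \<nu>. RN_deriv \<nu> (distr \<nu> \<nu> (\<phi> (g \<otimes>\<^bsub>G\<^esub> h))) x =
    RN_deriv \<nu> (distr \<nu> \<nu> (\<phi> g)) x * RN_deriv \<nu> (distr \<nu> \<nu> (\<phi> h)) (\<phi> (inv\<^bsub>G\<^esub> g) x)"
proof -
  interpret sigma_finite_measure \<nu> by (fact sf)
  let ?D = "\<lambda>g. RN_deriv \<nu> (distr \<nu> \<nu> (\<phi> g))"
  have ig: "inv\<^bsub>G\<^esub> g \<in> carrier G" using g by simp
  note [measurable] = phi_meas[OF g] phi_meas[OF h] phi_meas[OF ig]
  have "density \<nu> (\<lambda>x. ?D g x * ?D h (\<phi> (inv\<^bsub>G\<^esub> g) x)) = distr \<nu> \<nu> (\<phi> (g \<otimes>\<^bsub>G\<^esub> h))"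
  proof (rule measure_eqI)
    fix B assume "B \<in> sets (density \<nu> (\<lambda>x. ?D g x * ?D h (\<phi> (inv\<^bsub>G\<^esub> g) x)))"
    then have B [measurable]: "B \<in> sets \<nu>" by simp
    let ?C = "\<phi> g -` B \<inter> space \<nu>"
    have C: "?C \<in> sets \<nu>" by measurable
    have "emeasure (density \<nu> (\<lambda>x. ?D g x * ?D h (\<phi> (inv\<^bsub>G\<^esub> g) x))) B
        = (\<integral>\<^sup>+x. ?D g x * (?D h (\<phi> (inv\<^bsub>G\<^esub> g) x) * indicator B x) \<partial>\<nu>)"
      by (subst emeasure_density) (auto simp: mult.assoc)
    also have "\<dots> = (\<integral>\<^sup>+x. ?D h (\<phi> (inv\<^bsub>G\<^esub> g) x) * indicator B x \<partial>density \<nu> (?D g))"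
      by (subst nn_integral_density) auto
    also have "\<dots> = (\<integral>\<^sup>+x. ?D h (\<phi> (inv\<^bsub>G\<^esub> g) (\<phi> g x)) * indicator B (\<phi> g x) \<partial>\<nu>)"
      unfolding density_RN_push[OF G act qp sf g] by (subst nn_integral_distr) auto
    also have "\<dots> = (\<integral>\<^sup>+x. ?D h x * indicator ?C x \<partial>\<nu>)"
      by (rule nn_integral_cong) (auto simp: phi_inv g indicator_def)
    also have "\<dots> = emeasure (density \<nu> (?D h)) ?C"
      using C by (subst emeasure_density) auto
    also have "\<dots> = emeasure \<nu> (\<phi> h -` ?C \<inter> space \<nu>)"
      unfolding density_RN_push[OF G act qp sf h] using C by (subst emeasure_distr) auto
    also have "\<phi> h -` ?C \<inter> space \<nu> = \<phi> (g \<otimes>\<^bsub>G\<^esub> h) -` B \<inter> space \<nu>"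
      using g h measurable_space[OF phi_meas[OF h]] by (auto simp: composition_rule)
    also have "emeasure \<nu> \<dots> = emeasure (distr \<nu> \<nu> (\<phi> (g \<otimes>\<^bsub>G\<^esub> h))) B"
      using g h B by (subst emeasure_distr) auto
    finally show "emeasure (density \<nu> (\<lambda>x. ?D g x * ?D h (\<phi> (inv\<^bsub>G\<^esub> g) x))) B =
      emeasure (distr \<nu> \<nu> (\<phi> (g \<otimes>\<^bsub>G\<^esub> h))) B" .
  qed simp
  then have "AE x in \<nu>. ?D g x * ?D h (\<phi> (inv\<^bsub>G\<^esub> g) x) = ?D (g \<otimes>\<^bsub>G\<^esub> h) x"
    by (intro RN_deriv_unique) auto
  then show ?thesis by eventually_elim simp
qed

lemma koopman_fun_mult:
  assumes g: "g \<in> carrier G" and h: "h \<in> carrier G"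
  shows "AE x in \<nu>. koopman_fun G \<phi> \<nu> g (koopman_fun G \<phi> \<nu> h f) x = koopman_fun G \<phi> \<nu> (g \<otimes>\<^bsub>G\<^esub> h) f x"
  using RN_push_cocycle[OF g h] AE_space
proof eventually_elim
  case (elim x)
  have "\<phi> (inv\<^bsub>G\<^esub> (g \<otimes>\<^bsub>G\<^esub> h)) x = \<phi> (inv\<^bsub>G\<^esub> h) (\<phi> (inv\<^bsub>G\<^esub> g) x)"
    using g h elim(2) by (simp add: inv_mult_group composition_rule)
  then show ?case
    by (simp add: koopman_fun_def elim(1) enn2real_mult real_sqrt_mult)
qed

lemma koopman_lincomb_square_integrable:
  assumes "finite S" "S \<subseteq> carrier G" and u: "u \<in> square_integrable \<nu>"
  shows "(\<lambda>x. \<Sum>h\<in>S. \<xi> h * koopman_fun G \<phi> \<nu> h u x) \<in> square_integrable \<nu>"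
  using assms koopman_fun_square_integrable[OF G act qp sf _ u]
  by (intro square_integrable_lincomb) auto

text \<open>If \<open>g h = k\<close>, the two functions agree almost everywhere and unitarity leaves the norm of \<open>u\<close>.
  Otherwise they have disjoint supports: a point \<open>x\<close> in both would give \<open>y = (g h)\<inverse> x\<close> in
  \<open>A\<close> with \<open>k\<inverse> g h y = k\<inverse> x\<close> in \<open>A\<close> as well.\<close>

lemma koopman_inner_translates:
  assumes A: "A \<in> sets \<nu>" "0 < emeasure \<nu> A" "emeasure \<nu> A < \<infinity>"
    and in_G: "g \<in> carrier G" "h \<in> carrier G" "k \<in> carrier G"
    and disp: "\<And>x. g \<otimes>\<^bsub>G\<^esub> h \<noteq> k \<Longrightarrow> x \<in> A \<Longrightarrow> \<phi> (inv\<^bsub>G\<^esub> k \<otimes>\<^bsub>G\<^esub> (g \<otimes>\<^bsub>G\<^esub> h)) x \<notin> A"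
  defines "u \<equiv> \<lambda>x. complex_of_real (indicator A x / sqrt (measure \<nu> A))"
  shows "(LINT x|\<nu>. koopman_fun G \<phi> \<nu> g (koopman_fun G \<phi> \<nu> h u) x * cnj (koopman_fun G \<phi> \<nu> k u x))
    = (if g \<otimes>\<^bsub>G\<^esub> h = k then 1 else 0)"
proof (cases "g \<otimes>\<^bsub>G\<^esub> h = k")
  case True
  have pos: "measure \<nu> A > 0"
    using A by (simp add: measure_def enn2real_positive_iff)
  have um [measurable]: "u \<in> borel_measurable \<nu>" unfolding u_def using A(1) by measurable
  have km: "koopman_fun G \<phi> \<nu> k u \<in> borel_measurable \<nu>"
    using koopman_fun_meas[OF G act qp sf in_G(3) um] .
  have gm: "koopman_fun G \<phi> \<nu> g (koopman_fun G \<phi> \<nu> h u) \<in> borel_measurable \<nu>"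
    using koopman_fun_meas[OF G act qp sf in_G(1) koopman_fun_meas[OF G act qp sf in_G(2) um]] .
  have "(LINT x|\<nu>. koopman_fun G \<phi> \<nu> g (koopman_fun G \<phi> \<nu> h u) x * cnj (koopman_fun G \<phi> \<nu> k u x))
      = (LINT x|\<nu>. koopman_fun G \<phi> \<nu> k u x * cnj (koopman_fun G \<phi> \<nu> k u x))"
  proof (rule integral_cong_AE)
    show "AE x in \<nu>. koopman_fun G \<phi> \<nu> g (koopman_fun G \<phi> \<nu> h u) x * cnj (koopman_fun G \<phi> \<nu> k u x)
        = koopman_fun G \<phi> \<nu> k u x * cnj (koopman_fun G \<phi> \<nu> k u x)"
      using koopman_fun_mult[OF in_G(1,2), of u] unfolding True by eventually_elim simp
  qed (use km gm in auto)
  also have "\<dots> = (LINT x|\<nu>. u x * cnj (u x))"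
    unfolding koopman_fun_mult_cnj[OF G act qp sf in_G(3)]
    by (rule koopman_change_of_variables(2)[OF G act qp sf in_G(3)]) measurable
  also have "\<dots> = (LINT x|\<nu>. complex_of_real (indicator A x / measure \<nu> A))"
  proof (rule Bochner_Integration.integral_cong)
    fix x
    have "u x * cnj (u x) = complex_of_real ((indicator A x / sqrt (measure \<nu> A))\<^sup>2)"
      by (simp only: u_def complex_cnj_complex_of_real of_real_mult power2_eq_square)
    also have "(indicator A x / sqrt (measure \<nu> A))\<^sup>2 = indicator A x / measure \<nu> A"
      using pos by (simp add: power_divide indicator_def)
    finally show "u x * cnj (u x) = complex_of_real (indicator A x / measure \<nu> A)" .
  qed simp
  also have "\<dots> = 1"
    using pos A(1) sets.sets_into_space[OF A(1)] by (simp add: integral_complex_of_real Int_absorb2)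
  finally show ?thesis using True by simp
next
  case False
  have "koopman_fun G \<phi> \<nu> g (koopman_fun G \<phi> \<nu> h u) x * cnj (koopman_fun G \<phi> \<nu> k u x) = 0"
    if x: "x \<in> space \<nu>" for x
  proof -
    let ?y = "\<phi> (inv\<^bsub>G\<^esub> h) (\<phi> (inv\<^bsub>G\<^esub> g) x)"
    have y: "?y = \<phi> (inv\<^bsub>G\<^esub> (g \<otimes>\<^bsub>G\<^esub> h)) x"
      using in_G x by (simp add: inv_mult_group composition_rule)
    have "\<phi> (inv\<^bsub>G\<^esub> k \<otimes>\<^bsub>G\<^esub> (g \<otimes>\<^bsub>G\<^esub> h)) ?y = \<phi> (inv\<^bsub>G\<^esub> k \<otimes>\<^bsub>G\<^esub> (g \<otimes>\<^bsub>G\<^esub> h) \<otimes>\<^bsub>G\<^esub> inv\<^bsub>G\<^esub> (g \<otimes>\<^bsub>G\<^esub> h)) x"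
      unfolding y using in_G x by (subst composition_rule) auto
    also have "inv\<^bsub>G\<^esub> k \<otimes>\<^bsub>G\<^esub> (g \<otimes>\<^bsub>G\<^esub> h) \<otimes>\<^bsub>G\<^esub> inv\<^bsub>G\<^esub> (g \<otimes>\<^bsub>G\<^esub> h) = inv\<^bsub>G\<^esub> k"
      using in_G by (subst m_assoc) (auto simp del: inv_mult_group)
    finally have "?y \<notin> A \<or> \<phi> (inv\<^bsub>G\<^esub> k) x \<notin> A"
      using disp[OF False, of ?y] by auto
    then show ?thesis by (auto simp: koopman_fun_def u_def)
  qed
  then have "(LINT x|\<nu>. koopman_fun G \<phi> \<nu> g (koopman_fun G \<phi> \<nu> h u) x * cnj (koopman_fun G \<phi> \<nu> k u x))
      = (LINT x|\<nu>. 0)"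
    by (intro Bochner_Integration.integral_cong) auto
  then show ?thesis using False by simp
qed

lemma koopman_fun_lincomb:
  "koopman_fun G \<phi> \<nu> g (\<lambda>x. \<Sum>h\<in>S. c h * f h x) = (\<lambda>x. \<Sum>h\<in>S. c h * koopman_fun G \<phi> \<nu> g (f h) x)"
  by (simp add: koopman_fun_def sum_distrib_left mult_ac)

text \<open>The right-hand side is the coefficient at \<open>g\<close> of the regular representation for the restriction
  of \<open>\<xi>\<close> to \<open>S\<close>. By sesquilinearity the left-hand side is a double sum over \<open>h, k\<close> in \<open>S\<close>, of which only
  the terms with \<open>g h = k\<close> survive.\<close>

lemma koopman_coefficient_of_displaced_set:
  fixes \<xi> :: "'g \<Rightarrow> complex"
  assumes A: "A \<in> sets \<nu>" "0 < emeasure \<nu> A" "emeasure \<nu> A < \<infinity>"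
    and S: "finite S" "S \<subseteq> carrier G" and g: "g \<in> carrier G"
    and disp: "\<And>h k x. h \<in> S \<Longrightarrow> k \<in> S \<Longrightarrow> g \<otimes>\<^bsub>G\<^esub> h \<noteq> k \<Longrightarrow> x \<in> A
      \<Longrightarrow> \<phi> (inv\<^bsub>G\<^esub> k \<otimes>\<^bsub>G\<^esub> (g \<otimes>\<^bsub>G\<^esub> h)) x \<notin> A"
  defines "u \<equiv> \<lambda>x. complex_of_real (indicator A x / sqrt (measure \<nu> A))"
  defines "f \<equiv> \<lambda>x. \<Sum>h\<in>S. \<xi> h * koopman_fun G \<phi> \<nu> h u x"
  shows "inner_prod (L2 \<nu>) (koopman_rep G \<phi> \<nu> g (ae_eq \<nu> `` {f})) (ae_eq \<nu> `` {f})
      = (\<Sum>k | k \<in> S \<and> inv\<^bsub>G\<^esub> g \<otimes>\<^bsub>G\<^esub> k \<in> S. \<xi> (inv\<^bsub>G\<^esub> g \<otimes>\<^bsub>G\<^esub> k) * cnj (\<xi> k))"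
proof -
  let ?\<rho> = "koopman_fun G \<phi> \<nu>"
  have u: "u \<in> square_integrable \<nu>"
    unfolding u_def by (rule normalized_indicator_square_integrable[OF A(1,3)])
  have \<rho>u: "?\<rho> h u \<in> square_integrable \<nu>" if "h \<in> S" for h
    using koopman_fun_square_integrable[OF G act qp sf _ u] that S(2) by blast
  have \<rho>\<rho>u: "?\<rho> g (?\<rho> h u) \<in> square_integrable \<nu>" if "h \<in> S" for h
    using koopman_fun_square_integrable[OF G act qp sf g \<rho>u[OF that]] .
  have f: "f \<in> square_integrable \<nu>"
    unfolding f_def by (rule koopman_lincomb_square_integrable[OF S u])
  have int: "integrable \<nu> (\<lambda>x. ?\<rho> g (?\<rho> h u) x * cnj (?\<rho> k u x))" if "h \<in> S" "k \<in> S" for h k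
    using square_integrable_mult_cnj[OF \<rho>\<rho>u[OF that(1)] \<rho>u[OF that(2)]] .
  have "inner_prod (L2 \<nu>) (koopman_rep G \<phi> \<nu> g (ae_eq \<nu> `` {f})) (ae_eq \<nu> `` {f})
      = (LINT x|\<nu>. ?\<rho> g f x * cnj (f x))"
    by (simp add: koopman_rep_class[OF G act qp sf g f] L2_inner_class f
        koopman_fun_square_integrable[OF G act qp sf g f])
  also have "\<dots> = (LINT x|\<nu>. (\<Sum>k\<in>S. \<Sum>h\<in>S. \<xi> h * cnj (\<xi> k) * (?\<rho> g (?\<rho> h u) x * cnj (?\<rho> k u x))))"
  proof (intro Bochner_Integration.integral_cong refl)
    fix x
    have "?\<rho> g f x * cnj (f x) = (\<Sum>h\<in>S. \<Sum>k\<in>S. \<xi> h * ?\<rho> g (?\<rho> h u) x * cnj (\<xi> k * ?\<rho> k u x))"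
      unfolding f_def koopman_fun_lincomb by (simp only: cnj_sum sum_product)
    also have "\<dots> = (\<Sum>k\<in>S. \<Sum>h\<in>S. \<xi> h * ?\<rho> g (?\<rho> h u) x * cnj (\<xi> k * ?\<rho> k u x))"
      by (rule sum.swap)
    finally show "?\<rho> g f x * cnj (f x)
        = (\<Sum>k\<in>S. \<Sum>h\<in>S. \<xi> h * cnj (\<xi> k) * (?\<rho> g (?\<rho> h u) x * cnj (?\<rho> k u x)))"
      by (simp add: mult_ac)
  qed
  also have "\<dots> = (\<Sum>k\<in>S. \<Sum>h\<in>S. \<xi> h * cnj (\<xi> k) * (LINT x|\<nu>. ?\<rho> g (?\<rho> h u) x * cnj (?\<rho> k u x)))"
    using int by (simp add: Bochner_Integration.integral_sum Bochner_Integration.integrable_sum)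
  also have "\<dots> = (\<Sum>k\<in>S. \<Sum>h\<in>S. if h = inv\<^bsub>G\<^esub> g \<otimes>\<^bsub>G\<^esub> k then \<xi> h * cnj (\<xi> k) else 0)"
  proof (intro sum.cong refl)
    fix k h assume kh: "k \<in> S" "h \<in> S"
    then have c: "k \<in> carrier G" "h \<in> carrier G" using S(2) by auto
    have "g \<otimes>\<^bsub>G\<^esub> h = k \<longleftrightarrow> h = inv\<^bsub>G\<^esub> g \<otimes>\<^bsub>G\<^esub> k"
      using inv_solve_left[OF c(2) g c(1)] by auto
    then show "\<xi> h * cnj (\<xi> k) * (LINT x|\<nu>. ?\<rho> g (?\<rho> h u) x * cnj (?\<rho> k u x))
        = (if h = inv\<^bsub>G\<^esub> g \<otimes>\<^bsub>G\<^esub> k then \<xi> h * cnj (\<xi> k) else 0)"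
      using koopman_inner_translates[OF A g c(2) c(1)] disp[OF kh(2) kh(1)] unfolding u_def by simp
  qed
  also have "\<dots> = (\<Sum>k\<in>S. if inv\<^bsub>G\<^esub> g \<otimes>\<^bsub>G\<^esub> k \<in> S then \<xi> (inv\<^bsub>G\<^esub> g \<otimes>\<^bsub>G\<^esub> k) * cnj (\<xi> k) else 0)"
    using S(1) by (simp add: sum.delta')
  also have "\<dots> = (\<Sum>k | k \<in> S \<and> inv\<^bsub>G\<^esub> g \<otimes>\<^bsub>G\<^esub> k \<in> S. \<xi> (inv\<^bsub>G\<^esub> g \<otimes>\<^bsub>G\<^esub> k) * cnj (\<xi> k))"
    using S(1) by (simp add: sum.inter_filter)
  finally show "inner_prod (L2 \<nu>) (koopman_rep G \<phi> \<nu> g (ae_eq \<nu> `` {f})) (ae_eq \<nu> `` {f})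
      = (\<Sum>k | k \<in> S \<and> inv\<^bsub>G\<^esub> g \<otimes>\<^bsub>G\<^esub> k \<in> S. \<xi> (inv\<^bsub>G\<^esub> g \<otimes>\<^bsub>G\<^esub> k) * cnj (\<xi> k))" .
qed

end

section \<open>Truncating coefficients of the regular representation\<close>

lemma regular_coefficient_summable:
  assumes "group G" and \<xi>: "\<xi> \<in> vectors (ell2 G)" and g: "g \<in> carrier G"
  shows "(\<lambda>h. \<xi> (inv\<^bsub>G\<^esub> g \<otimes>\<^bsub>G\<^esub> h) * cnj (\<xi> h)) summable_on carrier G"
proof -
  interpret group G by fact
  have sq: "(\<lambda>h. (cmod (\<xi> h))\<^sup>2) summable_on carrier G"
    using \<xi> by (simp add: ell2_def)
  have "(\<lambda>h. (cmod (\<xi> (inv\<^bsub>G\<^esub> g \<otimes>\<^bsub>G\<^esub> h)))\<^sup>2) summable_on carrier G"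
  proof -
    have "bij_betw (\<lambda>h. inv\<^bsub>G\<^esub> g \<otimes>\<^bsub>G\<^esub> h) (carrier G) (carrier G)"
      using g by (simp add: bij_betw_def inj_on_cmult surj_const_mult)
    from summable_on_reindex_bij_betw[OF this, of "\<lambda>h. (cmod (\<xi> h))\<^sup>2"] sq
    show ?thesis by simp
  qed
  from summable_on_add[OF this sq]
  have "(\<lambda>h. norm (\<xi> (inv\<^bsub>G\<^esub> g \<otimes>\<^bsub>G\<^esub> h) * cnj (\<xi> h))) summable_on carrier G"
  proof (rule Infinite_Sum.abs_summable_on_comparison_test')
    show "norm (\<xi> (inv\<^bsub>G\<^esub> g \<otimes>\<^bsub>G\<^esub> h) * cnj (\<xi> h))
        \<le> (cmod (\<xi> (inv\<^bsub>G\<^esub> g \<otimes>\<^bsub>G\<^esub> h)))\<^sup>2 + (cmod (\<xi> h))\<^sup>2" for h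
      by (simp add: norm_mult cmod_mult_le_sum_squares)
  qed
  then show ?thesis by (rule abs_summable_summable)
qed

text \<open>The truncated coefficient at \<open>g\<close> is a partial sum, over \<open>S \<inter> g S\<close>, of the absolutely convergent series
  that defines the coefficient itself. So it is enough that \<open>S \<inter> g S\<close> contains a finite set \<open>T g\<close>
  beyond which all partial sums are within \<open>\<epsilon>\<close> of the limit, and this holds once \<open>S\<close> contains
  \<open>T g\<close> and \<open>g\<inverse> T g\<close>.\<close>

lemma regular_coefficient_truncation:
  assumes "group G" and \<xi>: "\<xi> \<in> vectors (ell2 G)"
    and K: "finite K" "K \<subseteq> carrier G" and "\<epsilon> > 0"
  obtains S where "finite S" "S \<subseteq> carrier G"
    "\<And>g. g \<in> K \<Longrightarrow> cmod (inner_prod (ell2 G) (regular_rep G g \<xi>) \<xi> -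
      (\<Sum>k | k \<in> S \<and> inv\<^bsub>G\<^esub> g \<otimes>\<^bsub>G\<^esub> k \<in> S. \<xi> (inv\<^bsub>G\<^esub> g \<otimes>\<^bsub>G\<^esub> k) * cnj (\<xi> k))) < \<epsilon>"
proof -
  interpret group G by fact
  let ?c = "\<lambda>g h. \<xi> (inv\<^bsub>G\<^esub> g \<otimes>\<^bsub>G\<^esub> h) * cnj (\<xi> h)"
  have inner: "inner_prod (ell2 G) (regular_rep G g \<xi>) \<xi> = (\<Sum>\<^sub>\<infinity>h\<in>carrier G. ?c g h)" for g
    unfolding ell2_def regular_rep_def by (auto intro!: infsum_cong)
  define captures where "captures g T \<longleftrightarrow> finite T \<and> T \<subseteq> carrier G \<and>
      (\<forall>Y. finite Y \<and> T \<subseteq> Y \<and> Y \<subseteq> carrier G \<longrightarrow> dist (sum (?c g) Y) (\<Sum>\<^sub>\<infinity>h\<in>carrier G. ?c g h) < \<epsilon>)"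
    for g T
  have "\<exists>T. captures g T" if "g \<in> K" for g
  proof -
    have "(?c g has_sum (\<Sum>\<^sub>\<infinity>h\<in>carrier G. ?c g h)) (carrier G)"
      using regular_coefficient_summable[OF \<open>group G\<close> \<xi>, of g] that K(2) by auto
    then have "eventually (\<lambda>Y. dist (sum (?c g) Y) (\<Sum>\<^sub>\<infinity>h\<in>carrier G. ?c g h) < \<epsilon>)
        (finite_subsets_at_top (carrier G))"
      unfolding has_sum_def using \<open>\<epsilon> > 0\<close> by (rule tendstoD)
    then show ?thesis
      unfolding eventually_finite_subsets_at_top captures_def .
  qed
  then obtain T where T: "\<And>g. g \<in> K \<Longrightarrow> captures g (T g)"
    by metis
  have T_fin: "finite (T g)" "T g \<subseteq> carrier G" if "g \<in> K" for g
    using T[OF that] unfolding captures_def by blast+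
  define S where "S = (\<Union>g\<in>K. T g \<union> (\<lambda>k. inv\<^bsub>G\<^esub> g \<otimes>\<^bsub>G\<^esub> k) ` T g)"
  have "finite S" using K(1) T_fin(1) by (simp add: S_def)
  have "inv\<^bsub>G\<^esub> g \<otimes>\<^bsub>G\<^esub> k \<in> carrier G" if "g \<in> K" "k \<in> T g" for g k
    using that T_fin(2)[OF that(1)] K(2) by (intro m_closed inv_closed) auto
  then have "S \<subseteq> carrier G"
    unfolding S_def using T_fin(2) by blast
  show thesis
  proof (rule that[OF \<open>finite S\<close> \<open>S \<subseteq> carrier G\<close>])
    fix g assume g: "g \<in> K"
    let ?Y = "{k. k \<in> S \<and> inv\<^bsub>G\<^esub> g \<otimes>\<^bsub>G\<^esub> k \<in> S}"
    have "finite ?Y" using \<open>finite S\<close> by simp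
    moreover have "T g \<subseteq> ?Y" using g unfolding S_def by blast
    moreover have "?Y \<subseteq> carrier G" using \<open>S \<subseteq> carrier G\<close> by blast
    ultimately have "dist (sum (?c g) ?Y) (\<Sum>\<^sub>\<infinity>h\<in>carrier G. ?c g h) < \<epsilon>"
      using T[OF g] unfolding captures_def by blast
    then show "cmod (inner_prod (ell2 G) (regular_rep G g \<xi>) \<xi> - sum (?c g) ?Y) < \<epsilon>"
      by (simp only: inner dist_norm norm_minus_commute)
  qed
qed

section \<open>Weak containment of the regular representation\<close>

theorem proposition1p2:
  fixes G :: "('g, 'm) monoid_scheme"
    and \<nu> :: "'x::topological_space measure"
    and \<phi> :: "'g \<Rightarrow> 'x \<Rightarrow> 'x"
  assumes "group G"
    and "countable (carrier G)"
    and "metrizable_space (euclidean :: 'x topology)"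
    and "locally_compact_space (euclidean :: 'x topology)"
    and "separable_space (euclidean :: 'x topology)"
    and "radon_measure \<nu>"
    and "acts_measurably G \<phi> \<nu>"
    and "quasi_preserves G \<phi> \<nu>"
    and "locally_somewhere_free G \<phi> \<nu>"
  shows "weakly_contained G (ell2 G) (regular_rep G) (L2 \<nu>) (koopman_rep G \<phi> \<nu>)"
  unfolding weakly_contained_def
proof (intro allI ballI impI, elim conjE)
  fix \<epsilon> :: real and \<xi> K
  assume \<epsilon>: "\<epsilon> > 0" and \<xi>: "\<xi> \<in> vectors (ell2 G)" and K: "finite K" "K \<subseteq> carrier G"
  interpret group G by fact
  have haus: "Hausdorff_space (euclidean :: 'x topology)"
    using assms(3) by (rule metrizable_imp_Hausdorff_space)
  have sc: "second_countable (euclidean :: 'x topology)"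
    using assms(3,5) by (rule metrizable_separable_imp_second_countable)
  have sf: "sigma_finite_measure \<nu>"
    using haus assms(4) sc assms(6) by (rule radon_measure_sigma_finite)
  have sets: "sets \<nu> = sets borel" using assms(6) by (simp add: radon_measure_def)
  have meas: "\<phi> g \<in> measurable \<nu> \<nu>" if "g \<in> carrier G" for g
    using assms(7) that by (simp add: acts_measurably_def)
  obtain S where S: "finite S" "S \<subseteq> carrier G"
    and approx: "\<And>g. g \<in> K \<Longrightarrow> cmod (inner_prod (ell2 G) (regular_rep G g \<xi>) \<xi> -
      (\<Sum>k | k \<in> S \<and> inv\<^bsub>G\<^esub> g \<otimes>\<^bsub>G\<^esub> k \<in> S. \<xi> (inv\<^bsub>G\<^esub> g \<otimes>\<^bsub>G\<^esub> k) * cnj (\<xi> k))) < \<epsilon>"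
    using regular_coefficient_truncation[OF \<open>group G\<close> \<xi> K \<epsilon>] by blast
  \<comment> \<open>The elements that have to displace \<open>A\<close>; the identity, which arises when \<open>g h = k\<close>, cannot.\<close>
  define L where "L = (\<lambda>(g, h, k). inv\<^bsub>G\<^esub> k \<otimes>\<^bsub>G\<^esub> (g \<otimes>\<^bsub>G\<^esub> h)) ` (K \<times> S \<times> S) - {\<one>\<^bsub>G\<^esub>}"
  have "inv\<^bsub>G\<^esub> k \<otimes>\<^bsub>G\<^esub> (g \<otimes>\<^bsub>G\<^esub> h) \<in> carrier G" if "g \<in> K" "h \<in> S" "k \<in> S" for g h k
    using that K(2) S(2) by (intro m_closed inv_closed) auto
  then have L: "finite L" "L \<subseteq> carrier G"
    using K(1) S(1) by (auto simp: L_def)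
  obtain F where F: "F \<in> sets \<nu>" "emeasure \<nu> F > 0"
    and free: "\<forall>\<gamma>\<in>L. \<gamma> \<noteq> \<one>\<^bsub>G\<^esub> \<longrightarrow> (AE x in \<nu>. x \<in> F \<longrightarrow> \<phi> \<gamma> x \<noteq> x)"
    using assms(9) L unfolding locally_somewhere_free_def by blast
  have L_meas: "\<phi> \<gamma> \<in> measurable \<nu> \<nu>" if "\<gamma> \<in> L" for \<gamma>
    using that L(2) meas by blast
  have L_free: "AE x in \<nu>. x \<in> F \<longrightarrow> \<phi> \<gamma> x \<noteq> x" if "\<gamma> \<in> L" for \<gamma>
    using that free by (simp add: L_def)
  obtain B where B: "B \<in> sets \<nu>" "emeasure \<nu> B > 0" "\<And>\<gamma> x. \<gamma> \<in> L \<Longrightarrow> x \<in> B \<Longrightarrow> \<phi> \<gamma> x \<notin> B"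
    by (rule positive_subset_displaced_by_finite[of \<nu> L \<phi> F, OF haus sc sets L(1) L_meas F L_free])
      blast+
  obtain A where A: "A \<in> sets \<nu>" "A \<subseteq> B" "0 < emeasure \<nu> A" "emeasure \<nu> A < \<infinity>"
    using sigma_finite_measure.positive_subset_finite[OF sf B(1,2)] by blast
  have disp: "\<phi> (inv\<^bsub>G\<^esub> k \<otimes>\<^bsub>G\<^esub> (g \<otimes>\<^bsub>G\<^esub> h)) x \<notin> A"
    if "g \<in> K" "h \<in> S" "k \<in> S" "g \<otimes>\<^bsub>G\<^esub> h \<noteq> k" "x \<in> A" for g h k x
  proof -
    have c: "g \<in> carrier G" "h \<in> carrier G" "k \<in> carrier G" using that K S by auto
    have "inv\<^bsub>G\<^esub> k \<otimes>\<^bsub>G\<^esub> (g \<otimes>\<^bsub>G\<^esub> h) \<noteq> \<one>\<^bsub>G\<^esub>"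
      using c that(4) inv_solve_left[of "\<one>\<^bsub>G\<^esub>" k "g \<otimes>\<^bsub>G\<^esub> h"] by auto
    then have "inv\<^bsub>G\<^esub> k \<otimes>\<^bsub>G\<^esub> (g \<otimes>\<^bsub>G\<^esub> h) \<in> L"
      unfolding L_def using that by (auto intro!: image_eqI[of _ _ "(g, h, k)"])
    then show ?thesis using B(3) A(2) that(5) by blast
  qed
  define u where "u = (\<lambda>x. complex_of_real (indicator A x / sqrt (measure \<nu> A)))"
  define f where "f = (\<lambda>x. \<Sum>h\<in>S. \<xi> h * koopman_fun G \<phi> \<nu> h u x)"
  have coeff: "inner_prod (L2 \<nu>) (koopman_rep G \<phi> \<nu> g (ae_eq \<nu> `` {f})) (ae_eq \<nu> `` {f})
      = (\<Sum>k | k \<in> S \<and> inv\<^bsub>G\<^esub> g \<otimes>\<^bsub>G\<^esub> k \<in> S. \<xi> (inv\<^bsub>G\<^esub> g \<otimes>\<^bsub>G\<^esub> k) * cnj (\<xi> k))" if "g \<in> K" for g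
    unfolding f_def u_def
    by (rule koopman_coefficient_of_displaced_set[OF \<open>group G\<close> assms(7,8) sf A(1,3,4) S])
      (use that K(2) disp in auto)
  have "f \<in> square_integrable \<nu>"
    unfolding f_def u_def
    by (intro koopman_lincomb_square_integrable[OF \<open>group G\<close> assms(7,8) sf S]
        normalized_indicator_square_integrable A)
  then have f_vector: "ae_eq \<nu> `` {f} \<in> vectors (L2 \<nu>)"
    by (simp add: L2_def quotientI)
  have f_approx: "cmod (inner_prod (ell2 G) (regular_rep G g \<xi>) \<xi> -
      (\<Sum>i=1..1::nat. inner_prod (L2 \<nu>) (koopman_rep G \<phi> \<nu> g (ae_eq \<nu> `` {f})) (ae_eq \<nu> `` {f}))) < \<epsilon>"
    if "g \<in> K" for g
    using approx[OF that] by (simp add: coeff[OF that])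
  show "\<exists>(n::nat) \<eta>. (\<forall>i\<in>{1..n}. \<eta> i \<in> vectors (L2 \<nu>)) \<and>
      (\<forall>g\<in>K. cmod (inner_prod (ell2 G) (regular_rep G g \<xi>) \<xi> -
        (\<Sum>i=1..n. inner_prod (L2 \<nu>) (koopman_rep G \<phi> \<nu> g (\<eta> i)) (\<eta> i))) < \<epsilon>)"
    by (intro exI[of _ 1] exI[of _ "\<lambda>_. ae_eq \<nu> `` {f}"] conjI ballI f_vector f_approx)
qed

end
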